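(* Let $\mathbb{L}=(x_n)_{n=0}^{\infty}$ be a liken with uniqueness. If $\mathbb{L}$ is convex and has the Ockham's razor property, then $\mathbb{L}$ is isomorphic (as a liken) to the liken $\mathbb{N}^{*}=(\ln(n+1))_{n=0}^{\infty}$.
   Context: A liken is a sequence $\mathbb{L}=(x_n)_{n=0}^{\infty}$ of real numbers with $0=x_0<x_1<x_2<\cdots$ such that for all $n,m\in\mathbb{N}$ there is $k\in\mathbb{N}$ with $x_n+x_m=x_k$ (so $\mathbb{L}$ is a subsemigroup of $([0,\infty),+)$ tending to infinity). An element $u\in\mathbb{L}$ is undecomposable (irreducible) if $u=v+w$ with $v,w\in\mathbb{L}$ implies $v=0$ or $w=0$; every element of $\mathbb{L}$ is a finite sum $\sum_i m_i a_i$ with $m_i\in\mathbb{N}$ of irreducible elements. Write the irreducible elements in increasing order as $a_1<a_2<\cdots$. The liken has uniqueness if each $x\in\mathbb{L}$ has exactly one such representation $x=\sum_i n_i(x)a_i$ with $(n_i(x))_i$ a finitely supported sequence of natural numbers; then $\mathrm{supp}(x)=\{i: n_i(x)\neq 0\}$. The liken $\mathbb{L}$ is convex if $2x_{k+1}>x_k+x_{k+2}$ for every $k\in\mathbb{N}$. For $n\in\mathbb{N}$ let $\mathbb{L}^{(n)}$ be the subsemigroup of $\mathbb{L}$ generated by $x_1,\dots,x_n$, and let $z_n=\min\{x\in\mathbb{L}^{(n)}: x>x_n\}$. The liken has the Ockham's razor property if for every $n$: $\mathrm{supp}(x_n)\cap\mathrm{supp}(z_n)=\emptyset$ implies $x_{n+1}=z_n$.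 Two likens $(x_n)_{n\ge0}$ and $(y_n)_{n\ge0}$ are isomorphic if the unique order isomorphism $x_n\mapsto y_n$ is additive, i.e. $x_i+x_j=x_k$ implies $y_i+y_j=y_k$. *)

theory Defs
  imports Complex_Main
begin

definition liken :: "(nat \<Rightarrow> real) \<Rightarrow> bool" where
  "liken x \<longleftrightarrow> x 0 = 0 \<and> strict_mono x \<and> (\<forall>n m. \<exists>k. x n + x m = x k)"

text \<open>Zero satisfies the defining implication trivially and has to be excluded explicitly.\<close>

definition irreducibles :: "(nat \<Rightarrow> real) \<Rightarrow> real set" where
  "irreducibles x =
     {u \<in> range x. u \<noteq> 0 \<and> (\<forall>v\<in>range x. \<forall>w\<in>range x. u = v + w \<longrightarrow> v = 0 \<or> w = 0)}"

text \<open>The family of irreducible elements is indexed by itself rather than by its increasing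
  enumeration \<open>a\<^sub>1 < a\<^sub>2 < \<dots>\<close> (which may be finite): \<open>c a\<^sub>i\<close> is the coefficient \<open>n\<^sub>i\<close>,
  and supports are sets of irreducible elements instead of sets of their indices.\<close>

definition is_representation :: "(nat \<Rightarrow> real) \<Rightarrow> (real \<Rightarrow> nat) \<Rightarrow> real \<Rightarrow> bool" where
  "is_representation x c u \<longleftrightarrow>
     finite {a. c a \<noteq> 0} \<and> {a. c a \<noteq> 0} \<subseteq> irreducibles x \<and>
     u = (\<Sum>a | c a \<noteq> 0. real (c a) * a)"

definition has_uniqueness :: "(nat \<Rightarrow> real) \<Rightarrow> bool" where
  "has_uniqueness x \<longleftrightarrow> (\<forall>u\<in>range x. \<exists>!c. is_representation x c u)"

definition coeffs :: "(nat \<Rightarrow> real) \<Rightarrow> real \<Rightarrow> real \<Rightarrow> nat" where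
  "coeffs x u = (THE c. is_representation x c u)"

definition supp :: "(nat \<Rightarrow> real) \<Rightarrow> real \<Rightarrow> real set" where
  "supp x u = {a. coeffs x u a \<noteq> 0}"

definition convex_liken :: "(nat \<Rightarrow> real) \<Rightarrow> bool" where
  "convex_liken x \<longleftrightarrow> (\<forall>k. 2 * x (k + 1) > x k + x (k + 2))"

definition add_closed :: "real set \<Rightarrow> bool" where
  "add_closed S \<longleftrightarrow> (\<forall>u\<in>S. \<forall>v\<in>S. u + v \<in> S)"

definition initial_subsemigroup :: "(nat \<Rightarrow> real) \<Rightarrow> nat \<Rightarrow> real set" where
  "initial_subsemigroup x n = add_closed hull (x ` {1..n})"

definition next_generated :: "(nat \<Rightarrow> real) \<Rightarrow> nat \<Rightarrow> real" where
  "next_generated x n = (LEAST u. u \<in> initial_subsemigroup x n \<and> u > x n)"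

text \<open>For \<open>n = 0\<close> there are no generators, so the minimum does not exist; the condition
  is only meaningful for \<open>n \<ge> 1\<close>.\<close>

definition ockham_razor :: "(nat \<Rightarrow> real) \<Rightarrow> bool" where
  "ockham_razor x \<longleftrightarrow>
     (\<forall>n\<ge>1. supp x (x n) \<inter> supp x (next_generated x n) = {} \<longrightarrow> x (n + 1) = next_generated x n)"

definition liken_isomorphic :: "(nat \<Rightarrow> real) \<Rightarrow> (nat \<Rightarrow> real) \<Rightarrow> bool" where
  "liken_isomorphic x y \<longleftrightarrow> (\<forall>i j k. x i + x j = x k \<longrightarrow> y i + y j = y k)"

definition log_liken :: "nat \<Rightarrow> real" where
  "log_liken n = ln (real n + 1)"

lemma liken_log_liken: "liken log_liken"
proof -
  have "\<exists>k. log_liken n + log_liken m = log_liken k" for n m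
  proof
    have "(real n + 1) * (real m + 1) = real (n * m + n + m) + 1"
      by (simp add: algebra_simps)
    then show "log_liken n + log_liken m = log_liken (n * m + n + m)"
      unfolding log_liken_def by (metis add_pos_nonneg add.commute ln_mult_pos of_nat_0_le_iff zero_less_one)
  qed
  then show ?thesis
    by (auto simp: liken_def log_liken_def strict_mono_def)
qed

lemma liken_isomorphic_converse:
  assumes "liken x" "liken y" "liken_isomorphic x y" "y i + y j = y k"
  shows "x i + x j = x k"
proof -
  obtain l where l: "x i + x j = x l"
    using assms(1) unfolding liken_def by blast
  then have "y l = y k"
    using assms(3,4) unfolding liken_isomorphic_def by metis
  then show ?thesis
    using assms(2) l by (metis liken_def strict_mono_eq)
qed

end

theory Submission
  imports Defs "HOL-Computational_Algebra.Primes"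
begin

text \<open>
  Number the elements from 1, \<open>y\<^sub>n = x\<^sub>n\<^sub>-\<^sub>1\<close>, and let \<open>f\<close> be the completely additive function on
  the positive integers with \<open>f p = y\<^sub>p\<close> at primes. By induction on \<open>N\<close>, \<open>f = y\<close> on \<open>{1..N}\<close> and the
  irreducible elements among \<open>y\<^sub>1, \<dots>, y\<^sub>N\<close> are the \<open>y\<^sub>p\<close> with \<open>p\<close> prime. For the step, the subsemigroup
  generated by \<open>y\<^sub>2, \<dots>, y\<^sub>N\<close> is the injective image under \<open>f\<close> of the \<open>N\<close>-smooth numbers above 1; let
  \<open>f u\<close> be its least element above \<open>y\<^sub>N\<close>. Since the gaps of \<open>y\<close> decrease, \<open>u \<ge> N + 2\<close> forces
  \<open>f u \<ge> 2 y\<^sub>N - y\<^sub>N\<^sub>-\<^sub>1 > y\<^sub>N\<^sub>+\<^sub>1\<close>. If \<open>N + 1\<close> is prime, \<open>y\<^sub>N\<^sub>+\<^sub>1\<close> is therefore a new irreducible. If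
  \<open>N + 1\<close> is composite and \<open>u \<noteq> N + 1\<close>, the razor gives a prime \<open>p\<close> dividing both \<open>N = p d\<close> and
  \<open>u\<close>; decreasing gaps then yield \<open>f (N + 1) \<le> f (p (d + 1)) \<le> f u\<close>, contradicting the choice of
  \<open>u\<close>. Hence \<open>u = N + 1\<close>, which is coprime to \<open>N\<close>, and the razor gives \<open>y\<^sub>N\<^sub>+\<^sub>1 = f (N + 1)\<close>.
\<close>

section \<open>Multiset sums and smooth numbers\<close>

lemma sum_mset_mem_hull:
  assumes "M \<noteq> {#}" "set_mset M \<subseteq> G"
  shows "sum_mset M \<in> add_closed hull G"
proof -
  have closed: "add_closed (add_closed hull G)"
    by (rule hull_in) (auto simp: add_closed_def)
  from assms show ?thesis
  proof (induction M)
    case (add a M)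
    have a: "a \<in> add_closed hull G"
      using add.prems(2) by (auto intro: hull_inc)
    show ?case
    proof (cases "M = {#}")
      case False
      then have "sum_mset M \<in> add_closed hull G"
        using add by auto
      then show ?thesis
        using a closed unfolding add_closed_def[of "add_closed hull G"] by simp
    qed (use a in simp)
  qed simp
qed

lemma Collect_count_neq_0: "{a. count M a \<noteq> 0} = set_mset M"
  by (simp add: count_eq_zero_iff)

lemma sum_mset_eq_sum_count:
  fixes M :: "real multiset"
  shows "sum_mset M = (\<Sum>a\<in>set_mset M. real (count M a) * a)"
proof -
  have "sum_mset M = (\<Sum>a\<in>A. real (count M a) * a)" if "finite A" "set_mset M \<subseteq> A" for A
    using that(2)
  proof (induction M)
    case (add b M)
    have "(\<Sum>a\<in>A. real (count (add_mset b M) a) * a)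
        = (\<Sum>a\<in>A. real (count M a) * a + (if a = b then a else 0))"
      by (intro sum.cong) (auto simp: algebra_simps)
    also have "\<dots> = sum_mset M + b"
      using add that(1) by (simp add: sum.distrib sum.delta)
    finally show ?case
      by simp
  qed simp
  then show ?thesis
    by blast
qed

text \<open>The conjunct \<open>n > 0\<close> matters: 0 has an empty prime factorization and would
  be smooth vacuously.\<close>

definition smooth :: "nat \<Rightarrow> nat \<Rightarrow> bool" where
  "smooth N n \<longleftrightarrow> n > 0 \<and> (\<forall>p\<in>prime_factors n. p \<le> N)"

lemma smooth_le: "0 < n \<Longrightarrow> n \<le> N \<Longrightarrow> smooth N n"
  by (auto simp: smooth_def dest!: in_prime_factors_imp_dvd dvd_imp_le)

lemma smooth_mult_iff: "smooth N (m * n) \<longleftrightarrow> smooth N m \<and> smooth N n"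
  by (cases "m = 0 \<or> n = 0") (auto simp: smooth_def prime_factors_product)

lemma not_primeE:
  fixes n :: nat
  assumes "1 < n" "\<not> prime n"
  obtains a b where "n = a * b" "1 < a" "1 < b"
proof -
  obtain a where a: "a dvd n" "a \<noteq> 1" "a \<noteq> n"
    using assms by (auto simp: prime_nat_iff)
  then obtain b where "n = a * b"
    by blast
  with a assms that[of a b] show thesis
    by (cases a; cases b) auto
qed

section \<open>The renumbered liken and its additive model\<close>

locale concave_unique_liken =
  fixes x :: "nat \<Rightarrow> real"
  assumes liken: "liken x"
    and unique: "has_uniqueness x"
    and concave: "convex_liken x"
begin

text \<open>Truncated subtraction makes \<open>y 0 = y 1\<close>, hence the positivity hypotheses on
  indices below.\<close>

definition y :: "nat \<Rightarrow> real" where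
  "y n = x (n - 1)"

definition f :: "nat \<Rightarrow> real" where
  "f n = (\<Sum>p\<in>#prime_factorization n. y p)"

lemma y_less_iff: "0 < m \<Longrightarrow> 0 < n \<Longrightarrow> y m < y n \<longleftrightarrow> m < n"
  using liken unfolding liken_def y_def by (auto simp: strict_mono_less)

lemma y_le_iff: "0 < m \<Longrightarrow> 0 < n \<Longrightarrow> y m \<le> y n \<longleftrightarrow> m \<le> n"
  using y_less_iff by (meson linorder_not_le)

lemma y_1: "y (Suc 0) = 0"
  using liken unfolding liken_def y_def by simp

lemma range_x_add: "v \<in> range x \<Longrightarrow> w \<in> range x \<Longrightarrow> v + w \<in> range x"
  using liken unfolding liken_def by fastforce

lemma range_xE:
  assumes "v \<in> range x"
  obtains n where "0 < n" "v = y n"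
proof -
  obtain k where "v = x k"
    using assms by blast
  then have "v = y (Suc k)"
    by (simp add: y_def)
  with that[of "Suc k"] show ?thesis
    by simp
qed

text \<open>Both sides are sums of \<open>m\<close> consecutive gaps, and each gap on the left lies
  at or beyond its counterpart.\<close>

lemma y_gap_mono:
  assumes "0 < i" "i \<le> j"
  shows "y (j + m) - y j \<le> y (i + m) - y i"
proof -
  have concave_step: "y (Suc (Suc k)) - y (Suc k) \<le> y (Suc k) - y k" if "0 < k" for k
    using concave that unfolding convex_liken_def y_def
    by (cases k) (auto dest: spec[of _ "k - 1"])
  have step: "y (Suc j) - y j \<le> y (Suc i) - y i" if "0 < i" "i \<le> j" for i j
    using that(2)
  proof (induction j rule: dec_induct)
    case (step j)
    then show ?case
      using concave_step[of j] that by simp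
  qed simp
  show ?thesis
  proof (induction m)
    case (Suc m)
    then show ?case
      using step[of "i + m" "j + m"] assms by simp
  qed simp
qed

lemma f_1: "f (Suc 0) = 0"
  by (simp add: f_def)

lemma f_prime: "prime p \<Longrightarrow> f p = y p"
  by (simp add: f_def prime_factorization_prime)

lemma f_mult: "0 < m \<Longrightarrow> 0 < n \<Longrightarrow> f (m * n) = f m + f n"
  by (simp add: f_def prime_factorization_mult)

lemma f_in_range: "f n \<in> range x"
proof -
  have "sum_mset (image_mset y M) \<in> range x" for M
  proof (induction M)
    case empty
    show ?case
      using liken unfolding liken_def by (metis image_mset_empty rangeI sum_mset.empty)
  next
    case (add p M)
    then show ?case
      by (auto intro!: range_x_add simp: y_def[of p])
  qed
  then show ?thesis
    by (simp add: f_def)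
qed

lemma f_pos:
  assumes "1 < n"
  shows "0 < f n"
proof -
  obtain p where p: "prime p" "p dvd n"
    using assms prime_factor_nat[of n] by auto
  obtain m where m: "n = p * m"
    using p by blast
  then have "f n = y p + f m"
    using assms p f_mult[of p m] f_prime[of p] by (cases "m = 0") (auto simp: prime_gt_0_nat)
  moreover have "0 \<le> f m"
    using f_in_range[of m] y_1 y_le_iff[of "Suc 0"] by (elim range_xE) auto
  moreover have "0 < y p"
    using y_less_iff[of "Suc 0" p] y_1 prime_gt_1_nat[OF p(1)] by simp
  ultimately show ?thesis
    by simp
qed

definition multiplicative_upto :: "nat \<Rightarrow> bool" where
  "multiplicative_upto N \<longleftrightarrow>
     (\<forall>n. 0 < n \<longrightarrow> n \<le> N \<longrightarrow> f n = y n) \<and> (\<forall>p. prime p \<longrightarrow> p \<le> N \<longrightarrow> y p \<in> irreducibles x)"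

section \<open>Unique factorization under the induction hypothesis\<close>

context
  fixes N :: nat
  assumes N: "2 \<le> N" and mult_upto: "multiplicative_upto N"
begin

lemma f_eq_y: "0 < n \<Longrightarrow> n \<le> N \<Longrightarrow> f n = y n"
  using mult_upto unfolding multiplicative_upto_def by blast

lemma y_mult: "0 < m \<Longrightarrow> 0 < n \<Longrightarrow> m * n \<le> N \<Longrightarrow> y (m * n) = y m + y n"
  using f_mult[of m n] f_eq_y[of "m * n"] f_eq_y[of m] f_eq_y[of n]
    order.trans[of m "m * n" N] order.trans[of n "m * n" N]
  by simp

lemma coeffs_f:
  assumes "smooth N n"
  shows "coeffs x (f n) = count (image_mset y (prime_factorization n))"
proof -
  let ?M = "image_mset y (prime_factorization n)"
  have "set_mset ?M \<subseteq> irreducibles x"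
    using assms mult_upto by (auto simp: smooth_def multiplicative_upto_def)
  moreover have "{a. count ?M a \<noteq> 0} = set_mset ?M"
    by (rule Collect_count_neq_0)
  ultimately have "is_representation x (count ?M) (f n)"
    unfolding is_representation_def f_def using sum_mset_eq_sum_count[of ?M] by simp
  moreover have "\<exists>!c. is_representation x c (f n)"
    using unique f_in_range unfolding has_uniqueness_def by blast
  ultimately show ?thesis
    unfolding coeffs_def by (simp add: the1_equality)
qed

lemma supp_f: "smooth N n \<Longrightarrow> supp x (f n) = y ` prime_factors n"
  unfolding supp_def coeffs_f Collect_count_neq_0 by simp

text \<open>Uniqueness recovers the multiset of the \<open>y p\<close>; injectivity of
  \<open>y\<close> on positive indices then recovers the primes.\<close>

lemma f_inj:
  assumes "smooth N m" "smooth N n" "f m = f n"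
  shows "m = n"
proof -
  have "inj_on y {0<..}"
    by (intro inj_onI) (metis greaterThan_iff linorder_neqE_nat order_less_irrefl y_less_iff)
  then have inverse:
    "image_mset (inv_into {0<..} y) (image_mset y (prime_factorization k)) = prime_factorization k"
    for k
    by (auto simp: multiset.map_comp in_prime_factors_iff prime_gt_0_nat
        intro!: multiset.map_ident_strong)
  have "image_mset y (prime_factorization m) = image_mset y (prime_factorization n)"
    using assms coeffs_f by (metis count_inject)
  then have "prime_factorization m = prime_factorization n"
    using inverse by metis
  then show ?thesis
    using assms by (metis prod_mset_prime_factorization_nat smooth_def)
qed

lemma f_gt_iff:
  assumes "smooth N n"
  shows "y N < f n \<longleftrightarrow> N < n"
proof
  assume "y N < f n"
  then show "N < n"
    using assms f_eq_y[of n] y_le_iff[of n N] by (force simp: smooth_def)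
next
  assume n: "N < n"
  obtain j where j: "0 < j" "f n = y j"
    using f_in_range range_xE by metis
  \<comment> \<open>Otherwise \<open>f j = y j = f n\<close>, and injectivity gives
    \<open>n = j\<close>, although \<open>j \<le> N < n\<close>.\<close>
  have "N < j"
    using f_inj[of n j] f_eq_y[of j] smooth_le[of j N] assms j n by force
  then show "y N < f n"
    using j N by (simp add: y_less_iff)
qed

section \<open>Inequalities from decreasing gaps\<close>

lemma f_ge_of_ge_N_plus_2:
  assumes ab: "2 \<le> a" "2 \<le> b" "N + 2 \<le> a * b" and le: "(a - 1) * b \<le> N" "a * (b - 1) \<le> N"
  shows "2 * y N - y (N - 1) \<le> f (a * b)"
proof -
  obtain c d where cd: "a = Suc c" "b = Suc d" "0 < c" "0 < d"
    using ab by (cases a; cases b) auto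
  \<comment> \<open>\<open>y a - y c\<close> is the sum of the \<open>d\<close> gaps of \<open>y\<close> between \<open>c * d\<close> and \<open>a * d\<close>; the first
    \<open>r\<close> of them cover \<open>y N - y (c * b)\<close> and the next one exceeds the last gap \<open>y N - y (N - 1)\<close>.\<close>
  define r where "r = N - c * b"
  have r: "N = c * b + r" "r < d"
    using le ab cd by (auto simp: r_def)
  have "a * d \<le> N" "c * d + r < a * d"
    using le r cd by auto
  have "a \<le> N" "b \<le> N"
    using le cd by (auto intro: order.trans[rotated])
  have "f (a * b) = y c + y b + (y a - y c)"
    using f_mult[of a b] f_eq_y[of a] f_eq_y[of b] \<open>a \<le> N\<close> \<open>b \<le> N\<close> ab by simp
  also have "y c + y b = y (c * b)"
    using y_mult[of c b] r cd by simp
  also have "y a - y c = y (a * d) - y (c * d)"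
    using y_mult[of a d] y_mult[of c d] \<open>a * d \<le> N\<close> \<open>c * d + r < a * d\<close> cd by simp
  finally have f_ab: "f (a * b) = y (c * b) + y (a * d) - y (c * d)"
    by simp
  have "y N - y (c * b) \<le> y (c * d + r) - y (c * d)"
    using y_gap_mono[of "c * d" "c * b" r] r cd by simp
  moreover have "y N - y (N - 1) \<le> y (Suc (c * d + r)) - y (c * d + r)"
    using y_gap_mono[of "c * d + r" "N - 1" 1] \<open>a * d \<le> N\<close> \<open>c * d + r < a * d\<close> N cd by simp
  moreover have "y (Suc (c * d + r)) \<le> y (a * d)"
    using \<open>c * d + r < a * d\<close> y_le_iff[of "Suc (c * d + r)" "a * d"] cd by simp
  ultimately show ?thesis
    using f_ab by simp
qed

text \<open>If \<open>a > d\<close>, the gap lost from \<open>a\<close> to \<open>a - 1\<close> is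
  at most the gap from \<open>d\<close> to \<open>Suc d\<close>, and
  \<open>(a - 1) * b \<le> N = k * d\<close>. If \<open>a \<le> d\<close>, the factor
  \<open>b\<close> is lowered instead, and its gap is split into several smaller ones.\<close>

lemma f_Suc_le:
  assumes ab: "2 \<le> a" "2 \<le> b" "Suc N = a * b" and kd: "2 \<le> k" "N = k * d"
  shows "f (Suc N) \<le> f (k * Suc d)"
proof -
  have "0 < d"
    using N kd by (cases d) auto
  have "Suc d \<le> N"
    using kd \<open>0 < d\<close> mult_le_mono1[of 2 k d] by linarith
  have "k \<le> N"
    using kd \<open>0 < d\<close> by simp
  have f_kd: "f (k * Suc d) = y k + y (Suc d)"
    using f_mult[of k "Suc d"] f_eq_y[of k] f_eq_y[of "Suc d"] kd \<open>k \<le> N\<close> \<open>Suc d \<le> N\<close> by simp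
  obtain a' b' where a'b': "a = Suc a'" "b = Suc b'" "0 < a'" "0 < b'"
    using ab by (cases a; cases b) auto
  have N_eq: "N = a' * b + b'" "N = a * b' + a'"
    using ab a'b' by auto
  have "a \<le> N" "b \<le> N"
    using N_eq a'b' mult_le_mono1[of 1 a' b] mult_le_mono2[of 1 b' a] by auto
  have f_ab: "f (Suc N) = y a + y b"
    using f_mult[of a b] f_eq_y[of a] f_eq_y[of b] ab \<open>a \<le> N\<close> \<open>b \<le> N\<close> by simp
  show ?thesis
  proof (cases "a \<le> d")
    case False
    have "y a - y a' \<le> y (Suc d) - y d"
      using y_gap_mono[of d a' 1] False a'b' \<open>0 < d\<close> by simp
    moreover have "y a' + y b = y (a' * b)"
      using y_mult[of a' b] N_eq a'b' by simp
    moreover have "y (a' * b) \<le> y N"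
      using y_le_iff N_eq N a'b' by simp
    moreover have "y N = y k + y d"
      using y_mult[of k d] kd \<open>0 < d\<close> by simp
    ultimately show ?thesis
      using f_kd f_ab by simp
  next
    case True
    \<comment> \<open>The choice of \<open>s\<close> makes the \<open>Suc s\<close> gaps between \<open>Suc s * b'\<close> and \<open>Suc s * b\<close>, which sum
      to \<open>y b - y b'\<close>, lie to the right of the \<open>Suc s\<close> gaps between \<open>d - s\<close> and \<open>Suc d\<close>.\<close>
    define s where "s = a' div k"
    have "k * s \<le> a'" "s \<le> a'"
      by (simp_all add: s_def)
    then have "s < d"
      using True a'b' by simp
    have "k < b"
    proof (rule ccontr)
      assume "\<not> k < b"
      then have "a * b \<le> d * k"
        using True by (intro mult_le_mono) auto
      then show False
        using ab kd by (simp add: mult.commute)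
    qed
    have "\<not> k dvd a"
    proof
      assume "k dvd a"
      then have "k dvd Suc N"
        using ab by simp
      then have "k dvd 1"
        using kd by (metis Suc_eq_plus1 dvd_add_right_iff dvd_triv_left)
      then show False
        using kd by simp
    qed
    \<comment> \<open>Division with remainder gives only \<open>a \<le> k * Suc s\<close>; equality
      fails because \<open>k\<close> divides \<open>N\<close> and hence not
      \<open>Suc N\<close>.\<close>
    have "a < k * Suc s"
    proof -
      have "a' < k * Suc s"
        using kd dividend_less_times_div[of k a'] by (simp add: s_def)
      then show ?thesis
        using \<open>\<not> k dvd a\<close> a'b' by (metis Suc_leI dvd_triv_left le_neq_implies_less)
    qed
    have "k * Suc d \<le> k * (Suc s * b)"
    proof -
      have "k * Suc d < (a * b) + b"
        using ab kd \<open>k < b\<close> by simp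
      also have "\<dots> = Suc a * b"
        by simp
      also have "\<dots> \<le> (k * Suc s) * b"
        using \<open>a < k * Suc s\<close> by (intro mult_le_mono1) simp
      finally show ?thesis
        unfolding mult.assoc by (rule less_imp_le)
    qed
    then have "Suc d \<le> Suc s * b"
      by (rule mult_le_cancel1[THEN iffD1, rule_format]) (use kd in simp)
    then have "d - s \<le> Suc s * b'"
      using a'b' by simp
    \<comment> \<open>This keeps \<open>Suc s * b\<close> within \<open>N\<close>, where
      \<open>y\<close> is known to turn products into sums.\<close>
    have "Suc s \<le> a'"
    proof -
      have "2 * s \<le> a'"
        using \<open>k * s \<le> a'\<close> kd mult_le_mono1[of 2 k s] by linarith
      then show ?thesis
        using a'b' by (cases s) auto
    qed
    then have "Suc s * b \<le> a' * b"
      by (rule mult_le_mono1)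
    then have "Suc s * b \<le> N"
      using N_eq by simp
    then have "Suc s * b' \<le> N"
      using a'b' by simp
    have "y b - y b' = y (Suc s * b) - y (Suc s * b')"
      using y_mult[of "Suc s" b] y_mult[of "Suc s" b'] \<open>Suc s * b \<le> N\<close> \<open>Suc s * b' \<le> N\<close> a'b' by simp
    also have "\<dots> = y (Suc s * b' + Suc s) - y (Suc s * b')"
      using a'b' by (simp add: algebra_simps)
    also have "\<dots> \<le> y (d - s + Suc s) - y (d - s)"
      using \<open>d - s \<le> Suc s * b'\<close> \<open>s < d\<close> by (intro y_gap_mono) auto
    also have "d - s + Suc s = Suc d"
      using \<open>s < d\<close> by simp
    finally have "y b - y b' \<le> y (Suc d) - y (d - s)" .
    moreover have "y a + y b' = y (a * b')"
      using y_mult[of a b'] N_eq a'b' by simp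
    moreover have "y (a * b') \<le> y (k * (d - s))"
    proof -
      have "a * b' \<le> k * (d - s)"
        using N_eq kd \<open>k * s \<le> a'\<close> by (simp add: diff_mult_distrib2)
      then show ?thesis
        using a'b' kd \<open>s < d\<close> by (simp add: y_le_iff)
    qed
    moreover have "y (k * (d - s)) = y k + y (d - s)"
      using y_mult[of k "d - s"] kd \<open>s < d\<close> by simp
    ultimately show ?thesis
      using f_kd f_ab by simp
  qed
qed

section \<open>Generated elements and the induction step\<close>

text \<open>The generators \<open>x 1\<close>, ..., \<open>x (N - 1)\<close> are \<open>y 2\<close>,
  ..., \<open>y N\<close>. The condition \<open>1 < n\<close> drops \<open>f 1 = 0\<close>, which no
  nonempty sum of generators reaches.\<close>

lemma initial_subsemigroup_eq: "initial_subsemigroup x (N - 1) = f ` {n. 1 < n \<and> smooth N n}"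
proof
  have "x ` {1..N - 1} \<subseteq> f ` {n. 1 < n \<and> smooth N n}"
  proof
    fix v assume "v \<in> x ` {1..N - 1}"
    then obtain j where j: "1 \<le> j" "j \<le> N - 1" "v = x j"
      by auto
    then have "v = f (Suc j)"
      using f_eq_y[of "Suc j"] N by (simp add: y_def)
    then show "v \<in> f ` {n. 1 < n \<and> smooth N n}"
      using j N smooth_le[of "Suc j" N] by auto
  qed
  moreover have "add_closed (f ` {n. 1 < n \<and> smooth N n})"
    unfolding add_closed_def
  proof (intro ballI)
    fix v w assume "v \<in> f ` {n. 1 < n \<and> smooth N n}" "w \<in> f ` {n. 1 < n \<and> smooth N n}"
    then obtain m n where mn: "v = f m" "1 < m" "smooth N m" "w = f n" "1 < n" "smooth N n"
      by auto
    then have "v + w = f (m * n)" "1 < m * n" "smooth N (m * n)"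
      using less_1_mult[of m n] by (simp_all add: f_mult smooth_mult_iff)
    then show "v + w \<in> f ` {n. 1 < n \<and> smooth N n}"
      by blast
  qed
  ultimately show "initial_subsemigroup x (N - 1) \<subseteq> f ` {n. 1 < n \<and> smooth N n}"
    unfolding initial_subsemigroup_def by (rule hull_minimal)
  show "f ` {n. 1 < n \<and> smooth N n} \<subseteq> initial_subsemigroup x (N - 1)"
  proof (rule image_subsetI)
    fix n assume "n \<in> {n. 1 < n \<and> smooth N n}"
    then have n: "1 < n" "smooth N n"
      by auto
    have "y p \<in> x ` {1..N - 1}" if "p \<in> prime_factors n" for p
    proof -
      have "1 < p" "p \<le> N"
        using that n(2) prime_gt_1_nat[of p] by (auto simp: smooth_def in_prime_factors_iff)
      then show ?thesis
        unfolding y_def by (intro imageI) auto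
    qed
    moreover have "prime_factorization n \<noteq> {#}"
      using n by (auto simp: prime_factorization_empty_iff)
    ultimately show "f n \<in> initial_subsemigroup x (N - 1)"
      unfolding initial_subsemigroup_def f_def by (intro sum_mset_mem_hull) auto
  qed
qed

text \<open>A \<open>LEAST\<close> over the reals needs an attained minimum. All candidates lie in
  \<open>range x\<close>, so the one of least index is minimal; \<open>N * N\<close> provides a
  candidate.\<close>

lemma next_generatedE:
  obtains u where "next_generated x (N - 1) = f u" "smooth N u" "N < u"
    "\<And>v. smooth N v \<Longrightarrow> N < v \<Longrightarrow> f u \<le> f v"
proof -
  define S where "S = {v. smooth N v \<and> N < v}"
  have generated: "u \<in> initial_subsemigroup x (N - 1) \<and> x (N - 1) < u \<longleftrightarrow> u \<in> f ` S" for u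
    using f_gt_iff N unfolding initial_subsemigroup_eq S_def y_def by auto
  have "N * N \<in> S"
    using N by (auto simp: S_def smooth_mult_iff smooth_le)
  have "\<exists>k. x k \<in> f ` S"
    using \<open>N * N \<in> S\<close> f_in_range by (metis image_eqI imageE)
  define k where "k = (LEAST k. x k \<in> f ` S)"
  have k: "x k \<in> f ` S"
    unfolding k_def using \<open>\<exists>k. x k \<in> f ` S\<close> by (rule LeastI_ex)
  have least: "x k \<le> f v" if "v \<in> S" for v
  proof -
    obtain j where "f v = x j"
      using f_in_range by blast
    then have "k \<le> j"
      unfolding k_def using that by (metis Least_le imageI)
    then show ?thesis
      using \<open>f v = x j\<close> liken unfolding liken_def by (simp add: strict_mono_less_eq)
  qed
  have "next_generated x (N - 1) = x k"
    unfolding next_generated_def generated using k least by (intro Least_equality) auto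
  with k least that show thesis
    unfolding S_def by auto
qed

text \<open>Both parts of a nontrivial decomposition would be among \<open>y 2\<close>, ...,
  \<open>y N\<close>, so \<open>y (Suc N)\<close> would be a generated element above
  \<open>y N\<close> but below the least such.\<close>

lemma irreducible_next:
  assumes "y (Suc N) < next_generated x (N - 1)"
  shows "y (Suc N) \<in> irreducibles x"
proof -
  obtain u where u: "next_generated x (N - 1) = f u"
    "\<And>v. smooth N v \<Longrightarrow> N < v \<Longrightarrow> f u \<le> f v"
    using next_generatedE by metis
  have False if vw: "v \<in> range x" "w \<in> range x" "y (Suc N) = v + w" "v \<noteq> 0" "w \<noteq> 0" for v w
  proof -
    obtain m n where mn: "0 < m" "v = y m" "0 < n" "w = y n"
      using vw range_xE by metis
    then have "0 < v" "0 < w"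
      using vw y_1 y_le_iff[of "Suc 0" m] y_le_iff[of "Suc 0" n] by auto
    then have "m \<le> N" "n \<le> N"
      using vw mn y_less_iff[of m "Suc N"] y_less_iff[of n "Suc N"] by auto
    then have f_mn: "smooth N (m * n)" "f (m * n) = y (Suc N)"
      using mn vw by (auto simp: smooth_mult_iff smooth_le f_mult f_eq_y)
    then have "N < m * n"
      using f_gt_iff[of "m * n"] y_less_iff[of N "Suc N"] N by simp
    then show False
      using u f_mn assms by force
  qed
  moreover have "y (Suc N) \<noteq> 0"
    using y_1 y_less_iff[of "Suc 0" "Suc N"] N by simp
  ultimately show ?thesis
    unfolding irreducibles_def by (auto simp: y_def)
qed

lemma multiplicative_upto_Suc:
  assumes "ockham_razor x"
  shows "multiplicative_upto (Suc N)"
proof -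
  obtain u where u: "next_generated x (N - 1) = f u" "smooth N u" "N < u"
    and u_min: "\<And>v. smooth N v \<Longrightarrow> N < v \<Longrightarrow> f u \<le> f v"
    using next_generatedE by metis
  \<comment> \<open>By minimality of \<open>u\<close>: \<open>f a\<close> and
    \<open>f ((a - 1) * b)\<close> are smaller than \<open>f u\<close>, so neither argument exceeds
    \<open>N\<close>.\<close>
  have factor: "a \<le> N \<and> (a - 1) * b \<le> N" if "u = a * b" "1 < a" "1 < b" for a b
  proof -
    have smooth: "smooth N a" "smooth N b"
      using u that by (simp_all add: smooth_mult_iff)
    have "f u = f a + f b"
      using f_mult[of a b] that by simp
    then have "a \<le> N"
      using u_min[of a] smooth f_pos[of b] that by force
    moreover have "f ((a - 1) * b) < f u"
      using \<open>f u = f a + f b\<close> f_mult[of "a - 1" b] f_eq_y[of "a - 1"] f_eq_y[of a] y_less_iff[of "a - 1" a]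
        that \<open>a \<le> N\<close> by simp
    moreover have "smooth N ((a - 1) * b)"
      using smooth \<open>a \<le> N\<close> that by (simp add: smooth_mult_iff smooth_le)
    ultimately show ?thesis
      using u_min[of "(a - 1) * b"] by force
  qed
  have "\<not> prime u"
    using u by (auto simp: smooth_def prime_factorization_prime)
  then obtain a b where ab: "u = a * b" "1 < a" "1 < b"
    using not_primeE[of u] u N by auto
  have below: "y (Suc N) < f u" if "u \<noteq> Suc N"
  proof -
    have "2 * y N - y (N - 1) \<le> f u"
      using f_ge_of_ge_N_plus_2[of a b] factor[of a b] factor[of b a] ab that u
      by (simp add: mult.commute)
    moreover have "y (Suc N) - y N < y N - y (N - 1)"
      using concave N unfolding convex_liken_def y_def
      by (auto dest!: spec[of _ "N - 2"] simp: numeral_2_eq_2 Suc_diff_Suc)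
    ultimately show ?thesis
      by simp
  qed
  have ockham: "y (Suc N) = f u" if "prime_factors N \<inter> prime_factors u = {}"
  proof -
    have "supp x (y N) \<inter> supp x (f u) = {}"
    proof -
      have "supp x (y N) = y ` prime_factors N"
        using supp_f[of N] f_eq_y[of N] smooth_le[of N N] N by simp
      moreover have "y p \<noteq> y q" if "p \<in> prime_factors N" "q \<in> prime_factors u" for p q
        using that \<open>prime_factors N \<inter> prime_factors u = {}\<close> y_less_iff[of p q] y_less_iff[of q p]
        by (metis disjoint_iff in_prime_factors_imp_prime less_irrefl linorder_neqE_nat prime_gt_0_nat)
      ultimately show ?thesis
        using supp_f[OF u(2)] by auto
    qed
    then have "x (N - 1 + 1) = next_generated x (N - 1)"
      using assms[unfolded ockham_razor_def, rule_format, of "N - 1"] N u(1) by (simp add: y_def)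
    then show ?thesis
      using u(1) N by (simp add: y_def)
  qed
  show ?thesis
  proof (cases "prime (Suc N)")
    case True
    then have "u \<noteq> Suc N"
      using u by (auto simp: smooth_def prime_factorization_prime)
    then have "y (Suc N) \<in> irreducibles x"
      using below irreducible_next u(1) by simp
    then show ?thesis
      using mult_upto f_prime[OF True] unfolding multiplicative_upto_def by (auto simp: le_Suc_eq)
  next
    case False
    then obtain m n where mn: "Suc N = m * n" "1 < m" "1 < n"
      using not_primeE[of "Suc N"] N by auto
    then have "m < Suc N" "n < Suc N"
      by simp_all
    have Suc_N: "smooth N (Suc N)"
      using mn(2,3) \<open>m < Suc N\<close> \<open>n < Suc N\<close> unfolding mn(1)[symmetric]
      by (subst mn(1)) (simp add: smooth_mult_iff smooth_le)
    have "u = Suc N"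
    proof (rule ccontr)
      assume "u \<noteq> Suc N"
      then obtain p where p: "p \<in> prime_factors N" "p \<in> prime_factors u"
        using ockham below by force
      then have "prime p"
        by auto
      obtain c d where cd: "N = p * d" "u = p * c"
        using p by (meson dvdE in_prime_factors_imp_dvd)
      have "1 < c" "0 < d"
        using cd u N \<open>\<not> prime u\<close> \<open>prime p\<close> by (cases c; cases d; force)+
      have "c \<le> N"
        using factor[of c p] cd \<open>1 < c\<close> prime_gt_1_nat[OF \<open>prime p\<close>] by (simp add: mult.commute)
      have "d < c"
        using cd u(3) by simp
      have "f (Suc N) \<le> f (p * Suc d)"
        using f_Suc_le[of m n p d] mn cd prime_ge_2_nat[OF \<open>prime p\<close>] by simp
      also have "\<dots> = f p + y (Suc d)"
        using f_mult[of p "Suc d"] f_eq_y[of "Suc d"] \<open>prime p\<close> \<open>d < c\<close> \<open>c \<le> N\<close> by (simp add: prime_gt_0_nat)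
      also have "\<dots> \<le> f p + y c"
        using y_le_iff[of "Suc d" c] \<open>d < c\<close> by simp
      also have "\<dots> = f u"
        using f_mult[of p c] f_eq_y[of c] cd \<open>prime p\<close> \<open>1 < c\<close> \<open>c \<le> N\<close> by (simp add: prime_gt_0_nat)
      finally have "f (Suc N) = f u"
        using u_min[OF Suc_N] by simp
      then show False
        using f_inj[OF Suc_N u(2)] \<open>u \<noteq> Suc N\<close> by simp
    qed
    have "prime_factors N \<inter> prime_factors u = {}"
    proof (safe, goal_cases)
      case (1 p)
      then have "p dvd N" "p dvd Suc N" "prime p"
        using \<open>u = Suc N\<close> by auto
      then show ?case
        by (metis dvd_add_right_iff Suc_eq_plus1 not_prime_unit)
    qed
    then have "f (Suc N) = y (Suc N)"
      using ockham \<open>u = Suc N\<close> by simp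
    then show ?thesis
      using mult_upto False unfolding multiplicative_upto_def by (auto simp: le_Suc_eq)
  qed
qed

end

section \<open>Base case and isomorphism\<close>

text \<open>\<open>y 2\<close> is the least nonzero element, so any sum of two nonzero elements
  exceeds it.\<close>

lemma multiplicative_upto_2: "multiplicative_upto 2"
proof -
  have "y 2 \<in> irreducibles x"
  proof -
    have pos: "0 < y 2"
      using y_1 y_less_iff[of "Suc 0" 2] by simp
    have least: "y 2 \<le> v" if "v \<in> range x" "v \<noteq> 0" for v
    proof -
      obtain n where "0 < n" "v = y n"
        using range_xE[OF \<open>v \<in> range x\<close>] by metis
      then show ?thesis
        using that y_1 y_le_iff[of 2 n] by (cases "n = 1") auto
    qed
    have "v = 0 \<or> w = 0" if "v \<in> range x" "w \<in> range x" "y 2 = v + w" for v w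
      using least[of v] least[of w] that pos by linarith
    then show ?thesis
      using pos unfolding irreducibles_def by (auto simp: y_def)
  qed
  moreover have "n = 1 \<or> n = 2" if "0 < n" "n \<le> 2" for n :: nat
    using that by auto
  ultimately show ?thesis
    unfolding multiplicative_upto_def using f_1 y_1 f_prime[of 2] prime_gt_0_nat
    by (metis One_nat_def not_prime_1 two_is_prime_nat)
qed

lemma f_eq_y_all:
  assumes "ockham_razor x" "0 < n"
  shows "f n = y n"
proof -
  have "multiplicative_upto (N + 2)" for N
  proof (induction N)
    case (Suc N)
    then show ?case
      using multiplicative_upto_Suc[of "N + 2"] assms by simp
  qed (use multiplicative_upto_2 in \<open>simp add: numeral_2_eq_2\<close>)
  from this[of n] show ?thesis
    using assms by (simp add: multiplicative_upto_def)
qed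

end

theorem theorem4p1:
  fixes x :: "nat \<Rightarrow> real"
  assumes "liken x"
    and "has_uniqueness x"
    and "convex_liken x"
    and "ockham_razor x"
  shows "liken_isomorphic x log_liken"
proof -
  interpret concave_unique_liken x
    by standard (use assms in auto)
  have "log_liken i + log_liken j = log_liken k" if "x i + x j = x k" for i j k
  proof -
    have "y (Suc i * Suc j) = y (Suc i) + y (Suc j)"
      using f_mult[of "Suc i" "Suc j"] f_eq_y_all[OF assms(4)] by simp
    also have "\<dots> = y (Suc k)"
      using that by (simp add: y_def)
    finally have "Suc i * Suc j = Suc k"
      by (metis linorder_neqE_nat less_irrefl mult_pos_pos y_less_iff zero_less_Suc)
    then have "(real i + 1) * (real j + 1) = real k + 1"
      by (metis of_nat_Suc of_nat_mult add.commute)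
    then show ?thesis
      by (metis log_liken_def ln_mult_pos add.commute of_nat_0_le_iff add_pos_nonneg zero_less_one)
  qed
  then show ?thesis
    by (auto simp: liken_isomorphic_def)
qed

end
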